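(* Let $A\in\mathbb{R}^{m\times n}$, $b\in\mathbb{R}^m$, $c\in\mathbb{R}^n$, and let $\eta,\tau>0$ satisfy $\eta\tau\|A\|_2^2<1$. Let $v=(v_x,v_y)$ be the infimal displacement vector of the primal-dual hybrid gradient (PDHG) operator for the linear program: minimize $c^\top x$ subject to $Ax=b$, $x\ge0$. Suppose $[z^\star,v]$ is a nondegenerate ray. Then every PDHG iterate sequence $z^k=(x^k,y^k)$ converging to the ray $[z^\star,v]$ fixes the active set after finitely many steps, i.e. the set $\{i\in N_1:x_i^k=0\}$ is the same for all sufficiently large $k$. Furthermore, the support $\{i\in[n]:x^k_i\ne0\}$ of $x^k$ is the same for all sufficiently large $k$.
   Context: The PDHG operator is $T(x,y)=(x^+,y^+)$ with $x^+=\mathrm{proj}_{\mathbb{R}^n_+}(x-\eta A^\top y-\eta c)$ and $y^+=y+\tau A(2x^+-x)-\tau b$; a PDHG iterate sequence satisfies $z^{k+1}=T(z^k)$ from some $z^0\in\mathbb{R}^{n+m}$. $\|A\|_2$ is the spectral norm. Let $M=\begin{bmatrix}\frac1\eta I_n & -A^\top\\ -A&\frac1\tau I_m\end{bmatrix}$, positive definite when $\eta\tau\|A\|_2^2<1$, and $\|z\|_M=\sqrt{z^\top Mz}$. $T$ is nonexpansive with respect to $\|\cdot\|_M$, $\mathrm{cl}(\mathrm{range}(T-I))$ is convex, and $v=(v_x,v_y)$ is its unique element of minimum $\|\cdot\|_M$-norm. One has $v_x\ge0$, $Av_x=0$, $A^\top v_y\ge0$. Index sets: $B=\{i\in[n]:(v_x)_i>0\}$,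 $N_1=\{i\in[n]:(v_x)_i=0,(A^\top v_y)_i=0\}$, $N_2=\{i\in[n]:(v_x)_i=0,(A^\top v_y)_i>0\}$. The auxiliary constraint system is $Ax=b+v_y/\tau$, $x_{N_1}\ge0$, $x_{N_2}=0$; its active set at $x$ is $\{i\in N_1:x_i=0\}$. For $z^\star=(x^\star,y^\star)\in\mathbb{R}^{n+m}$ the ray is $[z^\star,v]=\{z^\star+\lambda v:\lambda\ge0\}$. A sequence $(z^k)$ converges to $[z^\star,v]$ if there is an integer $k_0\ge0$ with $\|z^{k+k_0}-z^\star-kv\|\to0$ as $k\to\infty$. The ray is nondegenerate if for every $i\in N_1$: $x_i^\star>0$ if and only if $(A^\top y^\star+c)_i=0$. *)

theory Defs
  imports "HOL-Analysis.Analysis"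
begin

text \<open>
  The linear program: minimize \<open>c \<bullet> x\<close> subject to \<open>A *v x = b\<close>, \<open>x \<ge> 0\<close>, is given by its
  data \<open>A\<close>, \<open>b\<close>, \<open>c\<close>. Points of $R^{n+m}$ are pairs \<open>(x, y)\<close>; the norm and the inner product
  of the product type are the Euclidean ones of $R^{n+m}$. The spectral norm of \<open>A\<close> is
  \<open>onorm ((*v) A)\<close>.
\<close>

definition nonneg_orthant :: "(real^'n) set" where
  "nonneg_orthant = {x. \<forall>i. 0 \<le> x $ i}"

definition pdhg_op ::
  "real^'n^'m \<Rightarrow> real^'m \<Rightarrow> real^'n \<Rightarrow> real \<Rightarrow> real \<Rightarrow>
    (real^'n) \<times> (real^'m) \<Rightarrow> (real^'n) \<times> (real^'m)" where
  "pdhg_op A b c \<eta> \<tau> = (\<lambda>(x, y).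
     let x' = closest_point nonneg_orthant (x - \<eta> *\<^sub>R (transpose A *v y) - \<eta> *\<^sub>R c);
         y' = y + \<tau> *\<^sub>R (A *v (2 *\<^sub>R x' - x)) - \<tau> *\<^sub>R b
     in (x', y'))"

definition pdhg_sequence ::
  "real^'n^'m \<Rightarrow> real^'m \<Rightarrow> real^'n \<Rightarrow> real \<Rightarrow> real \<Rightarrow>
    (nat \<Rightarrow> (real^'n) \<times> (real^'m)) \<Rightarrow> bool" where
  "pdhg_sequence A b c \<eta> \<tau> z \<longleftrightarrow> (\<forall>k. z (Suc k) = pdhg_op A b c \<eta> \<tau> (z k))"

text \<open>The block matrix \<open>M\<close> with rows \<open>(I / \<eta>, - transpose A)\<close> and \<open>(- A, I / \<tau>)\<close>, as a linear
  operator on pairs.\<close>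

definition pdhg_metric ::
  "real^'n^'m \<Rightarrow> real \<Rightarrow> real \<Rightarrow> (real^'n) \<times> (real^'m) \<Rightarrow> (real^'n) \<times> (real^'m)" where
  "pdhg_metric A \<eta> \<tau> = (\<lambda>(x, y).
     ((1 / \<eta>) *\<^sub>R x - transpose A *v y, - (A *v x) + (1 / \<tau>) *\<^sub>R y))"

definition norm_M :: "real^'n^'m \<Rightarrow> real \<Rightarrow> real \<Rightarrow> (real^'n) \<times> (real^'m) \<Rightarrow> real" where
  "norm_M A \<eta> \<tau> z = sqrt (z \<bullet> pdhg_metric A \<eta> \<tau> z)"

text \<open>Only minimality is required here: when \<open>\<eta> * \<tau> * (onorm ((*v) A))\<^sup>2 < 1\<close>, the operator is
  nonexpansive in \<open>norm_M\<close>, the closure below is convex, and the minimizer is unique.\<close>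

definition infimal_displacement ::
  "real^'n^'m \<Rightarrow> real^'m \<Rightarrow> real^'n \<Rightarrow> real \<Rightarrow> real \<Rightarrow> (real^'n) \<times> (real^'m) \<Rightarrow> bool" where
  "infimal_displacement A b c \<eta> \<tau> v \<longleftrightarrow>
     v \<in> closure (range (\<lambda>z. pdhg_op A b c \<eta> \<tau> z - z)) \<and>
     (\<forall>w \<in> closure (range (\<lambda>z. pdhg_op A b c \<eta> \<tau> z - z)). norm_M A \<eta> \<tau> v \<le> norm_M A \<eta> \<tau> w)"

definition N1 :: "real^'n^'m \<Rightarrow> (real^'n) \<times> (real^'m) \<Rightarrow> 'n set" where
  "N1 A v = {i. fst v $ i = 0 \<and> (transpose A *v snd v) $ i = 0}"

text \<open>Active set at \<open>x\<close> of the system \<open>A *v x = b + (1 / \<tau>) *\<^sub>R snd v\<close>, \<open>x $ i \<ge> 0\<close> on \<open>N1\<close>,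
  \<open>x $ i = 0\<close> wherever \<open>fst v $ i = 0\<close> and \<open>(transpose A *v snd v) $ i > 0\<close>: only the
  inequality constraints are counted.\<close>

definition active_set ::
  "real^'n^'m \<Rightarrow> (real^'n) \<times> (real^'m) \<Rightarrow> real^'n \<Rightarrow> 'n set" where
  "active_set A v x = {i \<in> N1 A v. x $ i = 0}"

definition vec_support :: "real^'n \<Rightarrow> 'n set" where
  "vec_support x = {i. x $ i \<noteq> 0}"

text \<open>A ray \<open>{zs + l *\<^sub>R v | l. l \<ge> 0}\<close> is given by its base point \<open>zs\<close> and direction \<open>v\<close>.\<close>

definition converges_to_ray ::
  "(nat \<Rightarrow> 'a::real_normed_vector) \<Rightarrow> 'a \<Rightarrow> 'a \<Rightarrow> bool" where
  "converges_to_ray z zs v \<longleftrightarrow>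
     (\<exists>k0. (\<lambda>k. norm (z (k + k0) - zs - real k *\<^sub>R v)) \<longlonglongrightarrow> 0)"

definition nondegenerate_ray ::
  "real^'n^'m \<Rightarrow> real^'n \<Rightarrow> (real^'n) \<times> (real^'m) \<Rightarrow> (real^'n) \<times> (real^'m) \<Rightarrow> bool" where
  "nondegenerate_ray A c zs v \<longleftrightarrow>
     (\<forall>i \<in> N1 A v. fst zs $ i > 0 \<longleftrightarrow> (transpose A *v snd zs + c) $ i = 0)"

end

theory Submission
  imports Defs
begin

text \<open>
  The iteration acts coordinatewise on \<open>x\<close>: \<open>x\<^sub>i\<close> becomes \<open>max 0 (x\<^sub>i - \<eta> g\<^sub>i)\<close> with reduced cost
  \<open>g = transpose A *v y + c\<close>, and along a sequence converging to the ray both \<open>x\<^sub>i\<close> and \<open>g\<^sub>i\<close> are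
  affine in \<open>k\<close> up to \<open>o(1)\<close>. If \<open>x\<^sub>i\<close> grows, or converges to a positive limit, it is eventually
  nonzero. Otherwise \<open>x\<^sub>i\<close> tends to \<open>0\<close>; then \<open>g\<^sub>i\<close> is eventually bounded below by a positive
  constant, by nondegeneracy when its slope vanishes, so the projection truncates \<open>x\<^sub>i\<close> to \<open>0\<close>.
\<close>

text \<open>Euclidean distance is monotone in the coordinate distances, and the orthant constrains
  each coordinate separately, so projecting reduces to truncating real numbers.\<close>

lemma closest_point_nonneg_orthant:
  "closest_point nonneg_orthant w = (\<chi> i. max 0 (w $ i))" for w :: "real^'n"
proof -
  let ?S = "nonneg_orthant :: (real^'n) set" and ?p = "\<chi> i. max 0 (w $ i)"
  have S: "?S = {x. \<forall>i. x $ i \<ge> 0}"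
    by (simp add: nonneg_orthant_def)
  have "convex ?S" "closed ?S"
    unfolding S by (auto simp: convex_def intro: closed_positive_orthant)
  moreover have "?p \<in> ?S" by (simp add: S)
  moreover have "dist w ?p \<le> dist w u" if "u \<in> ?S" for u
    unfolding dist_vec_def
  proof (rule L2_set_mono)
    show "dist (w $ i) (?p $ i) \<le> dist (w $ i) (u $ i)" for i
      using that by (auto simp: S dist_real_def max_def abs_if dest: spec[of _ i])
  qed auto
  ultimately show ?thesis
    by (metis closest_point_unique)
qed

lemma affine_asymptotics_at_top:
  fixes h :: "nat \<Rightarrow> real"
  assumes "(\<lambda>k. h k - p - real k * q) \<longlonglongrightarrow> 0" and "q > 0"
  shows "filterlim h at_top sequentially"
proof -
  have "filterlim (\<lambda>k. real k * q) at_top sequentially"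
    using \<open>q > 0\<close> by (intro filterlim_at_top_mult_tendsto_pos[OF tendsto_const]
        filterlim_real_sequentially)
  from filterlim_tendsto_add_at_top[OF tendsto_add[OF assms(1) tendsto_const[of p]] this]
  show ?thesis by simp
qed

text \<open>Here \<open>q\<close> and \<open>s\<close> are the slopes along the ray of one
  coordinate and of its reduced cost. The sign combinations \<open>q < 0\<close>, and
  \<open>q = 0\<close> with \<open>s < 0\<close>, are refuted by the recursion itself, so no sign
  information on \<open>v\<close> has to be imported.\<close>

lemma truncated_affine_eventually_zero_or_nonzero:
  fixes x g :: "nat \<Rightarrow> real"
  assumes "\<eta> > 0" and step: "\<And>k. x (Suc k) = max 0 (x k - \<eta> * g k)"
    and x: "(\<lambda>k. x k - p - real k * q) \<longlonglongrightarrow> 0"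
    and g: "(\<lambda>k. g k - r - real k * s) \<longlonglongrightarrow> 0"
    and nondeg: "q = 0 \<Longrightarrow> s = 0 \<Longrightarrow> p > 0 \<longleftrightarrow> r = 0"
  shows "(\<forall>\<^sub>F k in sequentially. x k = 0) \<or> (\<forall>\<^sub>F k in sequentially. x k \<noteq> 0)"
proof -
  let ?d = "\<lambda>k. x k - \<eta> * g k"
  \<comment> \<open>The starting value may be negative; truncation acts from index 1 on.\<close>
  have nonneg: "\<forall>\<^sub>F k in sequentially. x k \<ge> 0"
    by (subst eventually_sequentially_Suc[symmetric]) (simp add: step)
  have zero: ?thesis if "\<forall>\<^sub>F k in sequentially. ?d k < 0"
    using that by (intro disjI1, subst eventually_sequentially_Suc[symmetric])
      (auto simp: step elim: eventually_mono)
  have nonzero: ?thesis if "\<forall>\<^sub>F k in sequentially. x k > 0"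
    by (rule disjI2[OF eventually_mono[OF that]]) simp
  have d: "(\<lambda>k. ?d k - (p - \<eta> * r) - real k * (q - \<eta> * s)) \<longlonglongrightarrow> 0"
    using tendsto_diff[OF x tendsto_mult[OF tendsto_const[of \<eta>] g]]
    by (simp add: algebra_simps)
  consider "q < 0" | "q > 0" | "q = 0" by linarith
  then show ?thesis
  proof cases
    case 1
    have "filterlim (\<lambda>k. - x k) at_top sequentially"
      using affine_asymptotics_at_top[of "\<lambda>k. - x k" "- p" "- q"] tendsto_minus[OF x] 1
      by (simp add: algebra_simps)
    then have "\<forall>\<^sub>F k in sequentially. - x k > 0"
      unfolding filterlim_at_top_dense by blast
    with nonneg have "\<forall>\<^sub>F k in sequentially. False"
      by eventually_elim simp
    then show ?thesis by simp
  next
    case 2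
    show ?thesis
      using affine_asymptotics_at_top[OF x 2] unfolding filterlim_at_top_dense
      by (intro nonzero) blast
  next
    case 3
    have xp: "x \<longlonglongrightarrow> p"
      using tendsto_add[OF x tendsto_const[of p]] 3 by simp
    then have x_Suc: "(\<lambda>k. x (Suc k)) \<longlonglongrightarrow> p"
      by (rule LIMSEQ_Suc)
    have "p \<ge> 0"
      using tendsto_lowerbound[OF xp nonneg] by simp
    consider "p > 0" | "s > 0" | "s < 0" | "p = 0" "s = 0"
      using \<open>p \<ge> 0\<close> by linarith
    then show ?thesis
    proof cases
      case 1
      then show ?thesis
        by (intro nonzero order_tendstoD(1)[OF xp])
    next
      case 2
      have "filterlim (\<lambda>k. - ?d k) at_top sequentially"
        using affine_asymptotics_at_top[of "\<lambda>k. - ?d k" "- (p - \<eta> * r)" "\<eta> * s"]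
          tendsto_minus[OF d] 2 3 \<open>\<eta> > 0\<close> by (simp add: algebra_simps)
      then have "\<forall>\<^sub>F k in sequentially. - ?d k > 0"
        unfolding filterlim_at_top_dense by blast
      then show ?thesis by (intro zero) simp
    next
      case s: 3
      have "filterlim ?d at_top sequentially"
        using affine_asymptotics_at_top[OF d] s 3 \<open>\<eta> > 0\<close> by (simp add: mult_pos_neg)
      \<comment> \<open>Truncation never lowers a value, so a diverging \<open>?d\<close> would push
        \<open>x (Suc k)\<close> above \<open>p + 1\<close>, against its limit
        \<open>p\<close>.\<close>
      then have "\<forall>\<^sub>F k in sequentially. ?d k > p + 1"
        unfolding filterlim_at_top_dense by blast
      moreover have "\<forall>\<^sub>F k in sequentially. x (Suc k) < p + 1"
        by (rule order_tendstoD(2)[OF x_Suc]) simp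
      ultimately have "\<forall>\<^sub>F k in sequentially. False"
        by eventually_elim (simp add: step)
      then show ?thesis by simp
    next
      case 4
      have dl: "?d \<longlonglongrightarrow> - \<eta> * r"
        using tendsto_add[OF d tendsto_const[of "- \<eta> * r"]] 3 4 by simp
      \<comment> \<open>Passing to the limit in the recursion gives only \<open>r \<ge> 0\<close>.
        Since \<open>p = 0\<close>, nondegeneracy excludes \<open>r = 0\<close>, and this strictness
        makes \<open>?d\<close> eventually negative.\<close>
      have "(\<lambda>k. x (Suc k)) \<longlonglongrightarrow> max 0 (- \<eta> * r)"
        unfolding step by (intro tendsto_max tendsto_const dl)
      then have "max 0 (- \<eta> * r) = 0"
        using LIMSEQ_unique[OF x_Suc] 4 by simp
      then have "r \<ge> 0"
        using \<open>\<eta> > 0\<close> by (simp add: max_def zero_le_mult_iff mult_le_0_iff split: if_splits)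
      then have "- \<eta> * r < 0"
        using nondeg[OF 3 4(2)] 4 \<open>\<eta> > 0\<close> by simp
      then show ?thesis
        by (intro zero order_tendstoD(2)[OF dl])
    qed
  qed
qed

lemma fst_pdhg_op_component:
  "fst (pdhg_op A b c \<eta> \<tau> z) $ i = max 0 (fst z $ i - \<eta> * (transpose A *v snd z + c) $ i)"
  by (simp add: pdhg_op_def Let_def case_prod_beta closest_point_nonneg_orthant algebra_simps)

lemma pdhg_component_eventually_zero_or_nonzero:
  assumes "\<eta> > 0" and nondeg: "nondegenerate_ray A c zs v"
    and seq: "pdhg_sequence A b c \<eta> \<tau> z" and conv: "converges_to_ray z zs v"
  shows "(\<forall>\<^sub>F k in sequentially. fst (z k) $ i = 0) \<or> (\<forall>\<^sub>F k in sequentially. fst (z k) $ i \<noteq> 0)"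
proof -
  obtain k0 where "(\<lambda>k. norm (z (k + k0) - zs - real k *\<^sub>R v)) \<longlonglongrightarrow> 0"
    using conv by (auto simp: converges_to_ray_def)
  then have e: "(\<lambda>k. z (k + k0) - zs - real k *\<^sub>R v) \<longlonglongrightarrow> 0"
    by (rule tendsto_norm_zero_cancel)
  have x: "(\<lambda>k. fst (z (k + k0)) $ i - fst zs $ i - real k * fst v $ i) \<longlonglongrightarrow> 0"
    using tendsto_vec_nth[OF tendsto_fst[OF e], of i] by simp
  \<comment> \<open>The reduced cost is affine in the dual variable: its linear part preserves the
    ray asymptotics, and \<open>c\<close> cancels in the difference.\<close>
  have "(\<lambda>k. transpose A *v snd (z (k + k0) - zs - real k *\<^sub>R v)) \<longlonglongrightarrow> 0"
    using bounded_linear.tendsto[OF matrix_vector_mul_bounded_linear tendsto_snd[OF e],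
        of "transpose A"] by simp
  from tendsto_vec_nth[OF this, of i]
  have g: "(\<lambda>k. (transpose A *v snd (z (k + k0)) + c) $ i - (transpose A *v snd zs + c) $ i
             - real k * (transpose A *v snd v) $ i) \<longlonglongrightarrow> 0"
    by (simp add: matrix_vector_mult_diff_distrib matrix_vector_mult_scaleR)
  have "(\<forall>\<^sub>F k in sequentially. fst (z (k + k0)) $ i = 0) \<or>
        (\<forall>\<^sub>F k in sequentially. fst (z (k + k0)) $ i \<noteq> 0)"
  proof (rule truncated_affine_eventually_zero_or_nonzero[OF \<open>\<eta> > 0\<close> _ x g])
    show "fst (z (Suc k + k0)) $ i
        = max 0 (fst (z (k + k0)) $ i - \<eta> * (transpose A *v snd (z (k + k0)) + c) $ i)" for k
      using seq by (simp add: pdhg_sequence_def fst_pdhg_op_component)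
    \<comment> \<open>Both slopes vanish exactly when \<open>i\<close> lies in
      \<open>N1 A v\<close>, where nondegeneracy applies.\<close>
    show "fst zs $ i > 0 \<longleftrightarrow> (transpose A *v snd zs + c) $ i = 0"
      if "fst v $ i = 0" "(transpose A *v snd v) $ i = 0"
      using nondeg that by (auto simp: nondegenerate_ray_def N1_def)
  qed
  then show ?thesis
    by (simp only: eventually_sequentially_seg[of "\<lambda>k. fst (z k) $ i = 0"]
        eventually_sequentially_seg[of "\<lambda>k. fst (z k) $ i \<noteq> 0"])
qed

theorem lemma4:
  fixes A :: "real^'n^'m" and b :: "real^'m" and c :: "real^'n"
    and \<eta> \<tau> :: real
    and v zs :: "(real^'n) \<times> (real^'m)"
    and z :: "nat \<Rightarrow> (real^'n) \<times> (real^'m)"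
  assumes "\<eta> > 0" and "\<tau> > 0"
    and "\<eta> * \<tau> * (onorm ((*v) A))\<^sup>2 < 1"
    and "infimal_displacement A b c \<eta> \<tau> v"
    and "nondegenerate_ray A c zs v"
    and "pdhg_sequence A b c \<eta> \<tau> z"
    and "converges_to_ray z zs v"
  shows "(\<exists>S. \<forall>\<^sub>F k in sequentially. active_set A v (fst (z k)) = S) \<and>
         (\<exists>S. \<forall>\<^sub>F k in sequentially. vec_support (fst (z k)) = S)"
proof -
  define Z where "Z = {i. \<forall>\<^sub>F k in sequentially. fst (z k) $ i = 0}"
  have "\<forall>\<^sub>F k in sequentially. fst (z k) $ i = 0 \<longleftrightarrow> i \<in> Z" for i
    using pdhg_component_eventually_zero_or_nonzero[OF assms(1,5-7), of i]
    by (cases "i \<in> Z") (auto simp: Z_def)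
  \<comment> \<open>Finitely many coordinates share one threshold, so the whole zero pattern freezes
    and determines both sets.\<close>
  then have Z: "\<forall>\<^sub>F k in sequentially. \<forall>i. fst (z k) $ i = 0 \<longleftrightarrow> i \<in> Z"
    by (rule eventually_all_finite)
  have "\<forall>\<^sub>F k in sequentially. active_set A v (fst (z k)) = N1 A v \<inter> Z"
    using Z by eventually_elim (auto simp: active_set_def)
  moreover have "\<forall>\<^sub>F k in sequentially. vec_support (fst (z k)) = - Z"
    using Z by eventually_elim (auto simp: vec_support_def)
  ultimately show ?thesis by blast
qed

end
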